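(* Let $m$ and $n \ge 2$ be natural numbers with $m = n^2 - 1$, and let $\nu$ be an integer with $0 < \nu < 2n-2$. If the diophantine equation $|x^2 - m y^2| = \nu$ has a solution $(x,y) \in \mathbb{Z}^2$, then $\nu$ is a perfect square. *)

theory Defs
  imports "HOL-Computational_Algebra.Computational_Algebra"
begin

end

theory Submission
  imports Defs
begin

text \<open>
  The idea is a descent under the action of a unit.  Put \<open>m = n\<^sup>2 - 1\<close>.  The number
  \<open>n + \<surd>m\<close> has norm \<open>1\<close>, so multiplying \<open>x + y\<surd>m\<close> by its inverse \<open>n - \<surd>m\<close> does not
  change the norm \<open>x\<^sup>2 - m y\<^sup>2\<close>, while \<open>y\<close> becomes \<open>n y - x\<close> (lemma \<open>norm_unit_mult\<close>).
  For \<open>x, y \<ge> 0\<close>, this makes \<open>\<bar>y\<bar>\<close> strictly smaller as long as \<open>y \<noteq> 0\<close> and the norm is below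
  \<open>2n - 2\<close> in absolute value (lemma \<open>unit_mult_decreases\<close>).  The descent can only stop at
  \<open>y = 0\<close>, where the absolute value of the norm is \<open>x\<^sup>2\<close>.
\<close>

text \<open>
  This is the multiplicativity of the norm: the coordinates on the left are those of
  \<open>(x + y\<surd>m) (n - \<surd>m)\<close>, and the second factor has norm \<open>n\<^sup>2 - m = 1\<close>.
\<close>

lemma norm_unit_mult:
  fixes n x y :: "'a :: comm_ring_1"
  shows "(n * x - (n\<^sup>2 - 1) * y)\<^sup>2 - (n\<^sup>2 - 1) * (n * y - x)\<^sup>2 = x\<^sup>2 - (n\<^sup>2 - 1) * y\<^sup>2"
  by (simp add: power2_eq_square algebra_simps)

text \<open>
  If the conclusion fails, then \<open>x\<close> lies outside the interval between \<open>(n - 1) y\<close> and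
  \<open>(n + 1) y\<close>.  This interval contains \<open>\<surd>m y\<close>, and at its endpoints the norm is
  \<open>-(2n - 2) y\<^sup>2\<close> and \<open>(2n + 2) y\<^sup>2\<close>, so outside it the norm is too large in absolute value.
\<close>

lemma unit_mult_decreases:
  fixes n x y :: int
  assumes "n \<ge> 1" "x \<ge> 0" "y > 0"
    and small: "\<bar>x\<^sup>2 - (n\<^sup>2 - 1) * y\<^sup>2\<bar> < 2 * n - 2"
  shows "\<bar>n * y - x\<bar> < y"
proof (rule ccontr)
  assume "\<not> \<bar>n * y - x\<bar> < y"
  then consider "x \<le> (n - 1) * y" | "x \<ge> (n + 1) * y"
    by (fastforce simp: algebra_simps)
  moreover have y2: "y\<^sup>2 \<ge> 1"
    using \<open>y > 0\<close> by (simp add: int_one_le_iff_zero_less)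
  ultimately show False
  proof cases
    case 1
    then have "x\<^sup>2 \<le> ((n - 1) * y)\<^sup>2"
      using \<open>x \<ge> 0\<close> by (intro power_mono)
    then have "(2 * n - 2) * y\<^sup>2 \<le> (n\<^sup>2 - 1) * y\<^sup>2 - x\<^sup>2"
      by (simp add: power2_eq_square algebra_simps)
    moreover have "2 * n - 2 \<le> (2 * n - 2) * y\<^sup>2"
      using mult_left_mono[OF y2, of "2 * n - 2"] \<open>n \<ge> 1\<close> by simp
    ultimately have "2 * n - 2 \<le> (n\<^sup>2 - 1) * y\<^sup>2 - x\<^sup>2"
      by (rule order_trans[rotated])
    then show False
      using small by linarith
  next
    case 2
    then have "((n + 1) * y)\<^sup>2 \<le> x\<^sup>2"
      using \<open>n \<ge> 1\<close> \<open>y > 0\<close> by (intro power_mono) auto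
    then have "(2 * n + 2) * y\<^sup>2 \<le> x\<^sup>2 - (n\<^sup>2 - 1) * y\<^sup>2"
      by (simp add: power2_eq_square algebra_simps)
    moreover have "2 * n + 2 \<le> (2 * n + 2) * y\<^sup>2"
      using mult_left_mono[OF y2, of "2 * n + 2"] \<open>n \<ge> 1\<close> by simp
    ultimately have "2 * n + 2 \<le> x\<^sup>2 - (n\<^sup>2 - 1) * y\<^sup>2"
      by (rule order_trans[rotated])
    then show False
      using small by linarith
  qed
qed

lemma small_norm_is_square:
  fixes n x y :: int
  assumes "n \<ge> 1" and "\<bar>x\<^sup>2 - (n\<^sup>2 - 1) * y\<^sup>2\<bar> < 2 * n - 2"
  shows "is_square \<bar>x\<^sup>2 - (n\<^sup>2 - 1) * y\<^sup>2\<bar>"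
  using assms(2)
proof (induction "nat \<bar>y\<bar>" arbitrary: x y rule: less_induct)
  case less
  show ?case
  proof (cases "y = 0")
    case True
    then show ?thesis by simp
  next
    case False
    \<comment> \<open>The descent step needs nonnegative coordinates; the norm does not see their signs.\<close>
    define x' where "x' = n * \<bar>x\<bar> - (n\<^sup>2 - 1) * \<bar>y\<bar>"
    define y' where "y' = n * \<bar>y\<bar> - \<bar>x\<bar>"
    have norm_eq: "x'\<^sup>2 - (n\<^sup>2 - 1) * y'\<^sup>2 = x\<^sup>2 - (n\<^sup>2 - 1) * y\<^sup>2"
      using norm_unit_mult[of n "\<bar>x\<bar>" "\<bar>y\<bar>"] by (simp add: x'_def y'_def)
    have "\<bar>y'\<bar> < \<bar>y\<bar>"
      unfolding y'_def using assms(1) False less.prems by (intro unit_mult_decreases) auto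
    then have "is_square \<bar>x'\<^sup>2 - (n\<^sup>2 - 1) * y'\<^sup>2\<bar>"
      using less.prems by (intro less.hyps) (auto simp: norm_eq)
    then show ?thesis
      by (simp only: norm_eq)
  qed
qed

theorem proposition13:
  fixes m n :: nat and \<nu> :: int
  assumes "n \<ge> 2"
    and "int m = int n ^ 2 - 1"
    and "0 < \<nu>" and "\<nu> < 2 * int n - 2"
    and "\<exists>x y :: int. \<bar>x ^ 2 - int m * y ^ 2\<bar> = \<nu>"
  shows "is_square \<nu>"
proof -
  obtain x y :: int where "\<bar>x\<^sup>2 - ((int n)\<^sup>2 - 1) * y\<^sup>2\<bar> = \<nu>"
    using assms(2,5) by auto
  then show ?thesis
    using small_norm_is_square[of "int n" x y] assms(1,4) by simp
qed

end
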